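(* Let $B$ be a strong balanced bipartite digraph of order $2a\geq 6$ with arc set $A(B)$. If $d^+(u)+d^-(v)\geq a+1$ for all vertices $u$ and $v$ from different partite sets such that $uv\notin A(B)$, then $B$ contains a Hamiltonian bypass.
   Context: All digraphs are finite, without loops and without multiple arcs; opposite arcs $xy$ and $yx$ may both be present. The arc from $x$ to $y$ is denoted $xy$, and if it is present one says that $x$ dominates $y$. The out-degree $d^+(x)$ is the number of vertices $y$ such that $xy$ is an arc, and the in-degree $d^-(x)$ is the number of vertices $y$ such that $yx$ is an arc. The order of a digraph is its number of vertices. A balanced bipartite digraph of order $2a$ is a digraph whose vertex set is partitioned into two partite sets $X$ and $Y$ with $|X|=|Y|=a$ such that every arc joins vertices from different partite sets (in either direction). A digraph is strong if for every pair of distinct vertices $x,y$ there are a directed path from $x$ to $y$ and a directed path from $y$ to $x$. A Hamiltonian bypass in a digraph of order $n$ is a (simple, directed) path $w_1w_2\ldots w_n$ passing through all vertices whose initial vertex dominates its terminal vertex, i.e. such that $w_1w_n$ is an arc. *)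

theory Defs
  imports "Graph_Theory.Graph_Theory"
begin

definition balanced_bipartite_digraph ::
  "('v, 'e) pre_digraph \<Rightarrow> 'v set \<Rightarrow> 'v set \<Rightarrow> nat \<Rightarrow> bool" where
  "balanced_bipartite_digraph B X Y a \<longleftrightarrow>
     digraph B \<and> verts B = X \<union> Y \<and> X \<inter> Y = {} \<and> card X = a \<and> card Y = a \<and>
     (\<forall>u v. u \<rightarrow>\<^bsub>B\<^esub> v \<longrightarrow> (u \<in> X \<and> v \<in> Y) \<or> (u \<in> Y \<and> v \<in> X))"

text \<open>
  The arc of a Hamiltonian bypass joins the initial vertex of the path to the terminal one;
  the opposite orientation would give a Hamiltonian cycle.
\<close>

definition hamiltonian_bypass :: "('v, 'e) pre_digraph \<Rightarrow> 'v list \<Rightarrow> bool" where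
  "hamiltonian_bypass B w \<longleftrightarrow> vpath w B \<and> set w = verts B \<and> hd w \<rightarrow>\<^bsub>B\<^esub> last w"

end

theory Submission
  imports Defs
begin

text \<open>
  Choose a perfect matching \<open>f\<close> among the arcs from \<open>X\<close> to \<open>Y\<close> (lemma \<open>perfect_matching\<close>) and
  contract every arc \<open>x \<rightarrow> f x\<close> to a vertex. The arcs from \<open>Y\<close> to \<open>X\<close> turn into a digraph on \<open>X\<close>, with
  an arc from \<open>x\<close> to \<open>x'\<close> whenever \<open>f x \<rightarrow> x'\<close>, and its Hamiltonian paths and cycles are those of the
  bipartite digraph that run through the matching. Arcs \<open>f x \<rightarrow> x\<close> become loops and are lost.
  Hence two distinct vertices \<open>u\<close>, \<open>v\<close> of the contraction without an arc from \<open>u\<close> to \<open>v\<close> satisfy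
  \<open>d\<^sup>+(u) + d\<^sup>-(v) \<ge> (a + 1) - 2 = a - 1\<close>, one less than Woodall's bound for Hamiltonicity, and the
  deficit occurs only if both \<open>u\<close> and \<open>v\<close> carry a lost loop.

  One below Woodall's bound, a digraph that is not Hamiltonian is nearly determined
  (theorem \<open>hamiltonian_or_two_cliques\<close>): it consists of a path and two complete parts \<open>S\<close> and \<open>T\<close>
  without arcs between them, and every vertex of the parts is dominated by the last vertex of the path and
  dominates the first one. This is read off the counting in Bondy and Thomassen's proof of Meyniel's theorem:
  there, a longest cycle and a detour around a shortest segment of it give an upper bound for a
  degree sum, which here coincides with the lower bound, so that every estimate is an equality.

  In the two-clique case all vertices of \<open>S\<close> and \<open>T\<close> carry lost loops, as the degree sums are extremal.
  An arc \<open>x \<rightarrow> f y\<close> with \<open>x\<close> and \<open>y\<close> in different parts closes a Hamiltonian bypass. If there is none,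
  then the degree condition for arcs from \<open>X\<close> to \<open>Y\<close> forces so many arcs between the parts and the path
  that after an exchange in \<open>f\<close> the path absorbs a vertex of \<open>S\<close> or \<open>T\<close>. Repeating this empties one
  part, which leaves a Hamiltonian cycle (lemma \<open>two_cliques_solved\<close>).

  It remains to get a bypass from a Hamiltonian cycle (lemma \<open>bypass_of_cycle\<close>). If some
  \<open>f x \<rightarrow> x\<close> is an arc, then the cycle without the arc \<open>x \<rightarrow> f x\<close> is a path from \<open>f x\<close> to \<open>x\<close>,
  and \<open>f x \<rightarrow> x\<close> makes it a bypass. Otherwise no loops are lost, and the contraction has
  \<open>d\<^sup>+(u) + d\<^sup>-(v) \<ge> a + 1\<close>, which makes it Hamiltonian-connected: any two vertices can be merged,
  and Woodall's theorem applies to the result. A Hamiltonian path from \<open>i\<close> to \<open>j \<noteq> i\<close> with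
  \<open>i \<rightarrow> f j\<close> is a bypass.
\<close>

section \<open>Counting neighbours\<close>

definition outs :: "('a \<Rightarrow> 'a \<Rightarrow> bool) \<Rightarrow> 'a \<Rightarrow> 'a set \<Rightarrow> nat" where
  "outs E v S = card {z \<in> S. E v z}"

definition ins :: "('a \<Rightarrow> 'a \<Rightarrow> bool) \<Rightarrow> 'a \<Rightarrow> 'a set \<Rightarrow> nat" where
  "ins E v S = card {z \<in> S. E z v}"

lemma ins_conv_outs: "ins E = outs (\<lambda>x y. E y x)"
  by (simp add: ins_def outs_def fun_eq_iff)

lemma outs_empty [simp]: "outs E v {} = 0"
  by (simp add: outs_def)

lemma outs_insert [simp]:
  "finite S \<Longrightarrow> x \<notin> S \<Longrightarrow> outs E v (insert x S) = outs E v S + of_bool (E v x)"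
proof -
  assume *: "finite S" "x \<notin> S"
  have "{z \<in> insert x S. E v z} = (if E v x then insert x {z \<in> S. E v z} else {z \<in> S. E v z})"
    by auto
  then show ?thesis using * by (simp add: outs_def)
qed

lemma outs_Un:
  "finite S \<Longrightarrow> finite T \<Longrightarrow> S \<inter> T = {} \<Longrightarrow> outs E v (S \<union> T) = outs E v S + outs E v T"
proof -
  assume *: "finite S" "finite T" "S \<inter> T = {}"
  have "{z \<in> S \<union> T. E v z} = {z \<in> S. E v z} \<union> {z \<in> T. E v z}" by auto
  with * show ?thesis unfolding outs_def by (simp only:) (rule card_Un_disjoint; auto)
qed

lemma outs_le_card: "finite S \<Longrightarrow> outs E v S \<le> card S"
  unfolding outs_def by (rule card_mono) auto

lemma outs_eq_0: "(\<And>z. z \<in> S \<Longrightarrow> \<not> E v z) \<Longrightarrow> outs E v S = 0"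
  unfolding outs_def by (metis (mono_tags, lifting) Collect_empty_eq card.empty)

lemma outs_eq_card: "(\<And>z. z \<in> S \<Longrightarrow> E v z) \<Longrightarrow> outs E v S = card S"
  unfolding outs_def by (rule arg_cong[where f = card]) auto

lemma outs_full: "finite S \<Longrightarrow> card S \<le> outs E v S \<Longrightarrow> z \<in> S \<Longrightarrow> E v z"
proof -
  assume *: "finite S" "card S \<le> outs E v S" "z \<in> S"
  then have "{z \<in> S. E v z} = S" unfolding outs_def by (intro card_seteq) auto
  with * show ?thesis by blast
qed

lemmas ins_empty [simp] = outs_empty[of "\<lambda>x y. E y x" for E, folded ins_conv_outs]
lemmas ins_insert [simp] = outs_insert[of _ _ "\<lambda>x y. E y x" for E, folded ins_conv_outs]
lemmas ins_Un = outs_Un[of _ _ "\<lambda>x y. E y x" for E, folded ins_conv_outs]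
lemmas ins_le_card = outs_le_card[of _ "\<lambda>x y. E y x" for E, folded ins_conv_outs]
lemmas ins_eq_0 = outs_eq_0[of _ "\<lambda>x y. E y x" for E, folded ins_conv_outs]
text \<open>
  A vertex that is never both a successor of \<open>u\<close> and a predecessor of \<open>v\<close> contributes at most once.
  The companion lemma \<open>exclusive_count_eq\<close> evaluates the case of equality.
\<close>

lemma exclusive_count:
  assumes "finite S" "\<And>z. z \<in> S \<Longrightarrow> \<not> (E u z \<and> E z v)"
  shows "outs E u S + ins E v S \<le> card S"
proof -
  have "outs E u S + ins E v S = card ({z \<in> S. E u z} \<union> {z \<in> S. E z v})"
    unfolding outs_def ins_def using assms by (intro card_Un_disjoint[symmetric]) auto
  also have "\<dots> \<le> card S" using assms(1) by (intro card_mono) auto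
  finally show ?thesis .
qed

lemma exclusive_count_eq:
  assumes "finite S" "\<And>z. z \<in> S \<Longrightarrow> \<not> (E u z \<and> E z v)"
    and "card S \<le> outs E u S + ins E v S" and "z \<in> S"
  shows "E u z \<or> E z v"
proof -
  have "outs E u S + ins E v S = card ({z \<in> S. E u z} \<union> {z \<in> S. E z v})"
    unfolding outs_def ins_def using assms by (intro card_Un_disjoint[symmetric]) auto
  then have "{z \<in> S. E u z} \<union> {z \<in> S. E z v} = S"
    using assms by (intro card_seteq) auto
  with assms(4) show ?thesis by blast
qed

text \<open>
  Of the two arcs that would be used to insert something (entered at \<open>a\<close>, left at \<open>b\<close>) between two
  consecutive vertices of a path, at most one is present. This accounts for all arcs except the one from
  the last vertex into \<open>a\<close> and the one from \<open>b\<close> to the first vertex.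
\<close>

lemma no_insertion_count:
  assumes "xs \<noteq> []" "distinct xs"
    and "\<And>ys zs. xs = ys @ zs \<Longrightarrow> ys \<noteq> [] \<Longrightarrow> zs \<noteq> [] \<Longrightarrow> \<not> (E (last ys) a \<and> E b (hd zs))"
  shows "ins E a (set xs) + outs E b (set xs)
    \<le> length xs - 1 + of_bool (E (last xs) a) + of_bool (E b (hd xs))"
  using assms
proof (induction xs rule: list_nonempty_induct)
  case (single x)
  then show ?case by simp
next
  case (cons x xs)
  have "ins E a (set xs) + outs E b (set xs)
    \<le> length xs - 1 + of_bool (E (last xs) a) + of_bool (E b (hd xs))"
  proof (rule cons.IH)
    show "distinct xs" using cons.prems by simp
    fix ys zs assume *: "xs = ys @ zs" "ys \<noteq> []" "zs \<noteq> []"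
    then show "\<not> (E (last ys) a \<and> E b (hd zs))"
      using cons.prems(2)[of "x # ys" zs] by auto
  qed
  moreover have "\<not> (E x a \<and> E b (hd xs))"
    using cons.prems(2)[of "[x]" xs] cons.hyps by simp
  ultimately show ?case using cons.hyps cons.prems(1)
    by (cases xs) (auto simp: of_bool_def split: if_splits)
qed

section \<open>Digraphs one below Woodall's bound\<close>

text \<open>
  Making the relation reflexive does not affect paths, lets a single vertex count as a closed path, and
  puts every vertex into its own neighbourhoods. The bound \<open>card V + 1\<close> thus stands
  for \<open>d\<^sup>+(u) + d\<^sup>-(v) \<ge> card V - 1\<close> in the loopless digraph.
\<close>

locale ore_digraph =
  fixes V :: "'a set" and E :: "'a \<Rightarrow> 'a \<Rightarrow> bool"
  assumes fin: "finite V"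
    and refl: "v \<in> V \<Longrightarrow> E v v"
    and ore: "u \<in> V \<Longrightarrow> v \<in> V \<Longrightarrow> \<not> E u v \<Longrightarrow> card V + 1 \<le> outs E u V + ins E v V"
begin

definition cyc :: "'a list \<Rightarrow> bool" where
  "cyc c \<longleftrightarrow> c \<noteq> [] \<and> distinct c \<and> set c \<subseteq> V \<and> successively E c \<and> E (last c) (hd c)"

lemma cyc_rotate: "cyc (xs @ ys) \<Longrightarrow> cyc (ys @ xs)"
  unfolding cyc_def by (cases "xs = []"; cases "ys = []") (auto simp: successively_append_iff)

lemma cyc_length: "cyc c \<Longrightarrow> length c \<le> card V"
  unfolding cyc_def using fin by (metis card_mono distinct_card)

text \<open>
  Strong connectivity follows from the degree condition: if no arc leaves \<open>S\<close>, then a successor count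
  inside \<open>S\<close> plus a predecessor count outside \<open>S\<close> is at most \<open>card V\<close>.
\<close>

lemma exit_arc:
  assumes "S \<subseteq> V" "S \<noteq> {}" "S \<noteq> V"
  shows "\<exists>u\<in>S. \<exists>v\<in>V - S. E u v"
proof (rule ccontr)
  assume no: "\<not> ?thesis"
  obtain u v where uv: "u \<in> S" "v \<in> V - S" using assms by blast
  have fS: "finite S" using assms fin finite_subset by blast
  have V: "V = S \<union> (V - S)" using assms by blast
  have "outs E u V = outs E u S + outs E u (V - S)" "ins E v V = ins E v S + ins E v (V - S)"
    using outs_Un[of S "V - S"] ins_Un[of S "V - S"] fS fin V by auto
  moreover have "outs E u (V - S) = 0" "ins E v S = 0"
    using no uv by (auto intro!: outs_eq_0 ins_eq_0)
  moreover have "outs E u S \<le> card S" "ins E v (V - S) \<le> card (V - S)"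
    using fS fin by (auto intro: outs_le_card ins_le_card)
  moreover have "card V = card S + card (V - S)"
    using V fS fin by (metis Diff_disjoint card_Un_disjoint finite_Diff)
  ultimately show False using ore[of u v] uv no assms by force
qed

text \<open>
  A closed path \<open>ps @ gs\<close> together with a detour \<open>qs\<close> that could replace the segment \<open>gs\<close>. The detour may
  start and end at the same vertex; then \<open>ps\<close> has length one.
\<close>

definition theta :: "'a list \<Rightarrow> 'a list \<Rightarrow> 'a list \<Rightarrow> bool" where
  "theta ps gs qs \<longleftrightarrow> ps \<noteq> [] \<and> qs \<noteq> [] \<and> distinct (ps @ gs @ qs) \<and> cyc (ps @ gs) \<and> cyc (ps @ qs)"

lemma thetaI:
  assumes "cyc (ps @ gs)" "distinct qs" "set qs \<subseteq> V" "set ps \<inter> set qs = {}" "set gs \<inter> set qs = {}"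
    and "successively E qs" "ps \<noteq> []" "qs \<noteq> []" "E (last ps) (hd qs)" "E (last qs) (hd ps)"
  shows "theta ps gs qs"
  using assms by (simp add: theta_def cyc_def successively_append_iff Int_Un_distrib)

text \<open>
  Leave the cycle by some arc and follow arcs outside it. By strong connectivity the set reached there
  has an exit arc, which can only lead back to the cycle.
\<close>

lemma theta_exists:
  assumes c: "cyc c" and ne: "set c \<noteq> V"
  shows "\<exists>ps gs qs. theta ps gs qs \<and> length (ps @ gs) = length c"
proof -
  let ?W = "V - set c"
  have cV: "set c \<subseteq> V" "c \<noteq> []" using c by (auto simp: cyc_def)
  obtain x w where xw: "x \<in> set c" "w \<in> ?W" "E x w"
    using exit_arc[of "set c"] cV ne by auto
  \<comment> \<open>\<open>U\<close> collects the ends of simple paths (rather than walks) from \<open>w\<close> outside the cycle, so that a detour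
    can be read off directly.\<close>
  define U where "U = {v. \<exists>qs. qs \<noteq> [] \<and> distinct qs \<and> set qs \<subseteq> ?W \<and> successively E qs
    \<and> hd qs = w \<and> last qs = v}"
  have "w \<in> U" unfolding U_def using xw by (intro CollectI exI[of _ "[w]"]) auto
  moreover have UW: "U \<subseteq> ?W" unfolding U_def using last_in_set by fastforce
  ultimately obtain u y where uy: "u \<in> U" "y \<in> V - U" "E u y"
    using exit_arc[of U] cV by (metis Diff_iff equals0D last_in_set subsetD subset_trans Diff_subset)
  then obtain qs where qs: "qs \<noteq> []" "distinct qs" "set qs \<subseteq> ?W" "successively E qs"
    "hd qs = w" "last qs = u" unfolding U_def by blast
  have "y \<in> set c"
  proof (rule ccontr)
    assume yc: "y \<notin> set c"
    have "y \<in> U"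
    proof (cases "y \<in> set qs")
      case True
      then obtain q1 q2 where q: "qs = q1 @ y # q2" using split_list by metis
      have "hd (q1 @ [y]) = w" using q qs by (cases q1) auto
      then show ?thesis unfolding U_def using q qs
        by (intro CollectI exI[of _ "q1 @ [y]"]) (auto simp: successively_append_iff)
    next
      case False
      then show ?thesis unfolding U_def using qs uy yc
        by (intro CollectI exI[of _ "qs @ [y]"]) (auto simp: successively_append_iff)
    qed
    with uy show False by blast
  qed
  then obtain c1 c2 where c12: "c = c1 @ y # c2" using split_list by metis
  define d where "d = y # c2 @ c1"
  have d: "cyc d" "set d = set c" "length d = length c"
    using cyc_rotate[of c1 "y # c2"] c c12 by (auto simp: d_def)
  then obtain d1 d2 where d12: "d = d1 @ x # d2" using xw split_list by metis
  define ps where "ps = d1 @ [x]"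
  have hd: "hd ps = y" using d12 by (cases d1) (auto simp: ps_def d_def)
  have pd: "d = ps @ d2" by (simp add: ps_def d12)
  have ps: "ps \<noteq> []" "distinct ps" "set ps \<subseteq> set c" "successively E ps" "last ps = x"
    using d(1,2) pd by (auto simp: cyc_def successively_append_iff ps_def)
  have "cyc (ps @ qs)"
    unfolding cyc_def using ps qs uy xw hd cV by (auto simp: successively_append_iff)
  moreover have "distinct (ps @ d2 @ qs)" using d pd qs by (auto simp: cyc_def)
  ultimately have "theta ps d2 qs" using d pd qs by (auto simp: theta_def ps_def)
  then show ?thesis using d pd by metis
qed

end

text \<open>
  The extremal choice that drives the argument. The length of \<open>qs\<close> is maximised last, and only for fixed
  \<open>ps\<close> and \<open>gs\<close>, in order to make the detour swallow everything that hangs on to it.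
\<close>

locale extremal_theta = ore_digraph +
  fixes ps gs qs :: "'a list"
  assumes theta: "theta ps gs qs"
    and longest: "cyc c \<Longrightarrow> length c \<le> length (ps @ gs)"
    and shortest_gap: "theta ps' gs' qs' \<Longrightarrow> length (ps' @ gs') = length (ps @ gs)
      \<Longrightarrow> length gs \<le> length gs'"
    and longest_bypass: "theta ps gs qs' \<Longrightarrow> length qs' \<le> length qs"
begin

text \<open>
  The set \<open>R\<close> of the vertices off the cycle includes the detour \<open>Q\<close>.
\<close>

abbreviation "P \<equiv> set ps"
abbreviation "G \<equiv> set gs"
abbreviation "Q \<equiv> set qs"
abbreviation "R \<equiv> V - P - G"

lemma theta_facts:
  shows "ps \<noteq> []" "qs \<noteq> []" "distinct ps" "distinct gs" "distinct qs"
    and "P \<inter> G = {}" "P \<inter> Q = {}" "G \<inter> Q = {}" "P \<subseteq> V" "G \<subseteq> V" "Q \<subseteq> V"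
    and "successively E ps" "successively E qs" "successively E gs"
    and "E (last ps) (hd qs)" "E (last qs) (hd ps)" "successively E (ps @ gs)"
    and "E (last (ps @ gs)) (hd ps)"
  using theta by (auto simp: theta_def cyc_def successively_append_iff)

lemma card_V: "card V = length ps + length gs + card R"
proof -
  have "card V = card (P \<union> G) + card (V - (P \<union> G))"
    using theta_facts fin by (metis Un_least card_Diff_subset card_mono finite_Un List.finite_set le_add_diff_inverse)
  then show ?thesis using theta_facts
    by (simp add: card_Un_disjoint distinct_card Diff_eq Int_assoc)
qed

text \<open>
  The way in which maximality of the cycle is used: nothing from outside can be inserted anywhere.
  With \<open>zs = []\<close> the place of insertion is the one between the end of \<open>gs\<close> and the start of \<open>ps\<close>.
\<close>

lemma no_detour:
  assumes "ps @ gs = ys @ zs" "ys \<noteq> []"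
    and "us \<noteq> []" "distinct us" "set us \<subseteq> R" "successively E us"
  shows "\<not> (E (last ys) (hd us) \<and> E (last us) (hd (zs @ ys)))"
proof
  assume *: "E (last ys) (hd us) \<and> E (last us) (hd (zs @ ys))"
  have "cyc (ys @ zs)" using theta assms by (simp add: theta_def)
  then have c: "cyc (zs @ ys)" by (rule cyc_rotate)
  have s: "set (ys @ zs) = P \<union> G" using assms(1) by (metis set_append)
  have "cyc ((zs @ ys) @ us)"
    unfolding cyc_def using c assms * s
    by (cases "zs = []") (auto simp: cyc_def successively_append_iff)
  from longest[OF this] show False using assms by (metis append_eq_append_conv2 length_append add_le_same_cancel1 le_zero_eq length_0_conv add.commute)
qed

lemma gap_nonempty: "gs \<noteq> []"
proof
  assume "gs = []"
  moreover have "cyc (ps @ qs)" using theta by (simp add: theta_def)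
  ultimately show False using longest theta_facts by fastforce
qed

text \<open>
  A connection between the detour and the gap, direct or through outside vertices, would give a detour
  around a shorter segment. In the new configuration the part of \<open>gs\<close> on the far side of \<open>g\<close> belongs to
  the retained path.
\<close>

lemma no_gap_shortcut:
  assumes w: "w \<in> Q" and g: "g \<in> G" and zs: "distinct zs" "set zs \<subseteq> R - Q" "successively E zs"
  shows "\<not> (E w (hd (zs @ [g])) \<and> E (last (w # zs)) g)" "\<not> (E g (hd (zs @ [w])) \<and> E (last (g # zs)) w)"
proof -
  obtain q1 q2 where q: "qs = q1 @ w # q2" using w split_list by metis
  obtain g1 g2 where gg: "gs = g1 @ g # g2" using g split_list by metis
  have dq: "distinct qs" "successively E qs" "set qs \<subseteq> V" "set qs \<inter> set gs = {}" "set qs \<inter> set ps = {}"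
    "E (last ps) (hd qs)" "E (last qs) (hd ps)" "ps \<noteq> []" "distinct gs"
    using theta_facts by auto
  have 1: "cyc (ps @ g1 @ g # g2)" using theta gg by (simp add: theta_def)
  then have 2: "cyc ((g # g2) @ ps @ g1)" using cyc_rotate[of "ps @ g1" "g # g2"] by simp
  show "\<not> (E w (hd (zs @ [g])) \<and> E (last (w # zs)) g)"
  proof
    assume a: "E w (hd (zs @ [g])) \<and> E (last (w # zs)) g"
    have "theta ((g # g2) @ ps) g1 ((q1 @ [w]) @ zs)"
    proof (rule thetaI)
      show "successively E ((q1 @ [w]) @ zs)"
        using dq a zs(3) by (cases zs) (auto simp: q successively_append_iff)
      show "E (last ((g # g2) @ ps)) (hd ((q1 @ [w]) @ zs))"
        using dq by (cases q1) (auto simp: q)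
      show "E (last ((q1 @ [w]) @ zs)) (hd ((g # g2) @ ps))"
        using a by (auto split: if_splits)
    qed (use 2 dq zs in \<open>auto simp: q gg\<close>)
    from shortest_gap[OF this] show False using gg by simp
  qed
  show "\<not> (E g (hd (zs @ [w])) \<and> E (last (g # zs)) w)"
  proof
    assume a: "E g (hd (zs @ [w])) \<and> E (last (g # zs)) w"
    have "theta (ps @ g1 @ [g]) g2 (zs @ w # q2)"
    proof (rule thetaI)
      show "successively E (zs @ w # q2)"
        using dq a zs(3) by (cases "zs = []") (auto simp: q successively_append_iff)
      show "E (last (ps @ g1 @ [g])) (hd (zs @ w # q2))"
        using a by (cases zs) auto
      show "E (last (zs @ w # q2)) (hd (ps @ g1 @ [g]))"
        using dq by (auto simp: q)
    qed (use 1 dq zs in \<open>auto simp: q gg\<close>)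
    from shortest_gap[OF this] show False using gg by simp
  qed
qed

lemma no_arcs_gap:
  assumes "w \<in> Q" and "g \<in> G"
  shows "\<not> E w g" "\<not> E g w"
  using no_gap_shortcut[OF assms, of "[]"] by auto

lemma no_shortcut:
  assumes "w \<in> Q" "g \<in> G" "z \<in> R"
  shows "\<not> (E w z \<and> E z g)" "\<not> (E g z \<and> E z w)"
  using no_gap_shortcut[OF assms(1,2), of "[z]"] no_arcs_gap assms by (cases "z \<in> Q"; auto)+

text \<open>
  A path with the ends of \<open>ps\<close> that absorbs the whole gap could be closed up through \<open>qs\<close> to a longer cycle.
\<close>

lemma no_absorption:
  assumes xs: "distinct xs" "successively E xs" "hd xs = hd ps" "last xs = last ps" "P \<subseteq> set xs" "set xs \<subseteq> P \<union> G"
  shows "set xs \<noteq> P \<union> G"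
proof
  assume s: "set xs = P \<union> G"
  have "length xs = length ps + length gs"
    using s xs theta_facts by (metis card_Un_disjoint distinct_card finite_set)
  moreover have "xs \<noteq> []" using xs(5) theta_facts(1) by auto
  moreover from this have "cyc (xs @ qs)"
    unfolding cyc_def using xs s theta_facts by (auto simp: successively_append_iff)
  ultimately show False using longest theta_facts by fastforce
qed

lemma ends_count:
  assumes "xs \<noteq> []" "distinct xs"
    and "\<And>ys zs. xs = ys @ zs \<Longrightarrow> ys \<noteq> [] \<Longrightarrow> zs \<noteq> [] \<Longrightarrow> \<not> (E (last ys) a \<and> E b (hd zs))"
  shows "ins E a (set xs) + outs E b (set xs) \<le> length xs + 1"
proof -
  have "ins E a (set xs) + outs E b (set xs)
      \<le> length xs - 1 + of_bool (E (last xs) a) + of_bool (E b (hd xs))"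
    using assms by (rule no_insertion_count)
  also have "\<dots> \<le> length xs + 1" using assms(1) by (cases xs) auto
  finally show ?thesis .
qed

lemma degree_split:
  "outs E v V = outs E v P + outs E v G + outs E v R"
  "ins E v V = ins E v P + ins E v G + ins E v R"
proof -
  have V: "V = (P \<union> G) \<union> R" using theta_facts(6-11) by blast
  have f: "finite R" using fin by blast
  have "outs E v ((P \<union> G) \<union> R) = outs E v P + outs E v G + outs E v R"
    using f theta_facts by (subst outs_Un, simp_all add: outs_Un) blast
  moreover have "ins E v ((P \<union> G) \<union> R) = ins E v P + ins E v G + ins E v R"
    using f theta_facts by (subst ins_Un, simp_all add: ins_Un) blast
  ultimately show "outs E v V = outs E v P + outs E v G + outs E v R"
    "ins E v V = ins E v P + ins E v G + ins E v R"
    using V by simp_all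
qed

lemma no_outer_insertion:
  assumes "v \<in> R" "ps = ys @ zs" "ys \<noteq> []" "zs \<noteq> []"
  shows "\<not> (E (last ys) v \<and> E v (hd zs))"
  using no_detour[of ys "zs @ gs" "[v]"] assms by simp

lemma outer_ends_count:
  assumes "v \<in> R" shows "ins E v P + outs E v P \<le> length ps + 1"
  using ends_count theta_facts no_outer_insertion assms by blast

lemma gap_degree_zero:
  assumes "w \<in> Q" shows "outs E w G = 0" "ins E w G = 0"
  using no_arcs_gap assms by (auto intro!: outs_eq_0 ins_eq_0)

lemma shortcut_counts:
  assumes "w \<in> Q" "g \<in> G"
  shows "outs E w R + ins E g R \<le> card R" "outs E g R + ins E w R \<le> card R"
  using exclusive_count[of R E w g] exclusive_count[of R E g w] no_shortcut assms fin by auto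

lemma ore_sum:
  assumes "u \<in> V" "v \<in> V" "\<not> E u v" "\<not> E v u"
  shows "2 * card V + 2 \<le> (outs E u V + ins E u V) + (outs E v V + ins E v V)"
  using ore[of u v] ore[of v u] assms by simp

lemma Q_outer: "w \<in> Q \<Longrightarrow> w \<in> R"
  using theta_facts(6-11) by blast

text \<open>
  If some gap vertex could be inserted into \<open>ps\<close>, let a path with the same ends absorb as many gap
  vertices as possible, say \<open>k > 0\<close> of them. For a gap vertex \<open>h\<close> that is left over, a vertex of the gap
  may count twice as a neighbour, but an absorbed one adds only one to the bound for the path. So the degree
  sum of \<open>h\<close> and a detour vertex \<open>w\<close> is at most \<open>2 * card V + 2 - k\<close>, contrary to \<open>ore_sum\<close>.
\<close>

lemma no_gap_insertion:
  assumes g: "g \<in> G" and split: "ps = ys @ zs" "ys \<noteq> []" "zs \<noteq> []"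
  shows "\<not> (E (last ys) g \<and> E g (hd zs))"
proof
  assume ins_g: "E (last ys) g \<and> E g (hd zs)"
  define absorbing where "absorbing xs \<longleftrightarrow> distinct xs \<and> successively E xs \<and> hd xs = hd ps
    \<and> last xs = last ps \<and> P \<subseteq> set xs \<and> set xs \<subseteq> P \<union> G" for xs
  have bound: "length xs \<le> card V" if "absorbing xs" for xs
  proof -
    have "set xs \<subseteq> V" using that theta_facts by (auto simp: absorbing_def)
    then show ?thesis using that fin by (metis absorbing_def card_mono distinct_card)
  qed
  have first: "absorbing (ys @ g # zs)"
    unfolding absorbing_def using theta_facts split ins_g g
    by (auto simp: successively_append_iff successively_Cons)
  obtain xs where xs: "absorbing xs" and max: "\<And>xs'. absorbing xs' \<Longrightarrow> length xs' \<le> length xs"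
    using ex_has_greatest_nat[of absorbing "ys @ g # zs" length "card V + 1"] first bound
    by (metis less_Suc_eq_le Suc_eq_plus1)
  have xs': "distinct xs" "successively E xs" "hd xs = hd ps" "last xs = last ps" "P \<subseteq> set xs"
    "set xs \<subseteq> P \<union> G" "xs \<noteq> []"
    using xs theta_facts(1) unfolding absorbing_def by auto
  obtain h where h: "h \<in> G" "h \<notin> set xs" using no_absorption[OF xs'(1-6)] xs' by blast
  obtain w where w: "w \<in> Q" using theta_facts by (meson last_in_set)
  have "\<not> (E (last us) h \<and> E h (hd vs))" if "xs = us @ vs" "us \<noteq> []" "vs \<noteq> []" for us vs
  proof
    assume a: "E (last us) h \<and> E h (hd vs)"
    have "absorbing (us @ h # vs)"
      using xs' h that a unfolding absorbing_def by (auto simp: successively_append_iff successively_Cons)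
    from max[OF this] show False using that by simp
  qed
  then have 1: "ins E h (set xs) + outs E h (set xs) \<le> length xs + 1"
    using ends_count xs' by blast
  let ?L = "G - set xs"
  have PG: "P \<union> G = set xs \<union> ?L" using xs' by blast
  have "outs E h P + outs E h G = outs E h (set xs) + outs E h ?L"
    "ins E h P + ins E h G = ins E h (set xs) + ins E h ?L"
    using outs_Un[of P G] outs_Un[of "set xs" ?L] ins_Un[of P G] ins_Un[of "set xs" ?L] PG theta_facts
    by auto
  moreover have "outs E h ?L \<le> card ?L" "ins E h ?L \<le> card ?L"
    by (auto intro: outs_le_card ins_le_card)
  moreover have "length ps + length gs = length xs + card ?L"
  proof -
    have "card (P \<union> G) = card P + card G"
      using theta_facts by (intro card_Un_disjoint) auto
    moreover have "card (set xs \<union> ?L) = card (set xs) + card ?L"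
      by (intro card_Un_disjoint) auto
    ultimately have "card P + card G = card (set xs) + card ?L" using PG by simp
    then show ?thesis using theta_facts(3,4) xs'(1) by (simp add: distinct_card)
  qed
  moreover have "length ps < length xs" using max[OF first] split by simp
  moreover have "2 * card V + 2 \<le> (outs E w V + ins E w V) + (outs E h V + ins E h V)"
    using ore_sum[of w h] no_arcs_gap[OF w h(1)] w h(1) theta_facts(9-11) by blast
  ultimately show False
    using 1 card_V degree_split[of w] degree_split[of h] gap_degree_zero[OF w]
      shortcut_counts[OF w h(1)] outer_ends_count[OF Q_outer[OF w]] by linarith
qed

lemma gap_ends_count:
  assumes "g \<in> G" shows "ins E g P + outs E g P \<le> length ps + 1"
  using ends_count theta_facts no_gap_insertion assms by blast

text \<open>
  The upper bounds for the neighbours of \<open>w\<close> and \<open>g\<close> in \<open>ps\<close>, in the gap and outside the cycle add up to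
  the lower bound of \<open>ore_sum\<close>, so each of them is attained. Everything below is drawn from these equalities.
\<close>

lemma tight:
  assumes w: "w \<in> Q" and g: "g \<in> G"
  shows "ins E w P + outs E w P = length ps + 1" "ins E g P + outs E g P = length ps + 1"
    and "outs E g G = card G" "ins E g G = card G"
    and "outs E w R + ins E g R = card R" "outs E g R + ins E w R = card R"
    and "(outs E w V + ins E w V) + (outs E g V + ins E g V) = 2 * card V + 2"
proof -
  have "2 * card V + 2 \<le> (outs E w V + ins E w V) + (outs E g V + ins E g V)"
    using ore_sum[of w g] no_arcs_gap[OF w g] w g theta_facts(9-11) by blast
  moreover have "outs E g G \<le> card G" "ins E g G \<le> card G"
    by (auto intro: outs_le_card ins_le_card)
  moreover have "card G = length gs" using theta_facts distinct_card by blast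
  moreover note card_V degree_split[of w] degree_split[of g] gap_degree_zero[OF w]
      shortcut_counts[OF w g] outer_ends_count[OF Q_outer[OF w]] gap_ends_count[OF g]
  ultimately show "ins E w P + outs E w P = length ps + 1" "ins E g P + outs E g P = length ps + 1"
    "outs E g G = card G" "ins E g G = card G"
    "outs E w R + ins E g R = card R" "outs E g R + ins E w R = card R"
    "(outs E w V + ins E w V) + (outs E g V + ins E g V) = 2 * card V + 2"
    by linarith+
qed

text \<open>
  Attaining the bound for a vertex that cannot be inserted takes both arcs at the ends of the path.
\<close>

lemma ends_adjacent:
  assumes "length ps + 1 \<le> ins E v P + outs E v P"
    and "\<And>ys zs. ps = ys @ zs \<Longrightarrow> ys \<noteq> [] \<Longrightarrow> zs \<noteq> [] \<Longrightarrow> \<not> (E (last ys) v \<and> E v (hd zs))"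
  shows "E (last ps) v \<and> E v (hd ps)"
proof -
  have "ins E v P + outs E v P \<le> length ps - 1 + of_bool (E (last ps) v) + of_bool (E v (hd ps))"
    using assms(2) theta_facts by (intro no_insertion_count) auto
  moreover have "length ps > 0" using theta_facts by simp
  ultimately show ?thesis using assms(1) by (cases "E (last ps) v"; cases "E v (hd ps)") auto
qed

lemma some_bypass: obtains w where "w \<in> Q" using theta_facts by (meson last_in_set)
lemma some_gap: obtains g where "g \<in> G" using gap_nonempty by (meson last_in_set)

lemma attached:
  assumes v: "v \<in> G \<union> Q"
  shows "E (last ps) v" "E v (hd ps)"
proof -
  obtain w g where wg: "w \<in> Q" "g \<in> G" using some_bypass some_gap by metis
  have "E (last ps) v \<and> E v (hd ps)"
  proof (rule ends_adjacent)
    show "length ps + 1 \<le> ins E v P + outs E v P"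
      using v tight(1)[of v g] tight(2)[of w v] wg by auto
    show "\<not> (E (last ys) v \<and> E v (hd zs))" if "ps = ys @ zs" "ys \<noteq> []" "zs \<noteq> []" for ys zs
      using v no_gap_insertion[of v] no_outer_insertion[of v] Q_outer[of v] that by blast
  qed
  then show "E (last ps) v" "E v (hd ps)" by auto
qed

lemma gap_clique: "g \<in> G \<Longrightarrow> h \<in> G \<Longrightarrow> E g h"
  using outs_full[of G E g h] tight(3) some_bypass by (metis List.finite_set le_refl)

lemma exactly_one:
  assumes "w \<in> Q" "g \<in> G" "z \<in> R"
  shows "E w z \<or> E z g" "E g z \<or> E z w"
proof -
  have "finite R" using fin by blast
  then show "E w z \<or> E z g" "E g z \<or> E z w"
    using exclusive_count_eq[of R E w g z] exclusive_count_eq[of R E g w z]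
      no_shortcut[OF assms(1,2)] tight(5,6)[OF assms(1,2)] assms(3) by (metis le_refl)+
qed

lemma bypass_clique: "w \<in> Q \<Longrightarrow> x \<in> Q \<Longrightarrow> E w x"
  using exactly_one(1)[of w _ x] no_arcs_gap(1)[of x] some_gap Q_outer[of x] by blast

lemma last_gap: "last gs \<in> G" "hd gs \<in> G" "last (ps @ gs) = last gs" "hd (gs @ ps) = hd gs"
  using gap_nonempty by auto

text \<open>
  If \<open>z\<close> is dominated from both the detour and the gap, tightness makes all of their vertices dominate
  \<open>z\<close> and none be dominated by it. Since \<open>z\<close> can be reached from both sides, any way from \<open>z\<close> back
  to \<open>w\<close> would lengthen the cycle. This leaves too few successors of \<open>z\<close> and predecessors of \<open>w\<close> for the
  missing arc from \<open>z\<close> to \<open>w\<close>.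
\<close>

lemma no_common_sink:
  assumes z: "z \<in> R - Q" and w: "w \<in> Q" and g: "g \<in> G"
  shows "\<not> (E w z \<and> E g z)"
proof
  assume a: "E w z \<and> E g z"
  have zV: "z \<in> R" using z by simp
  have no_out: "\<not> E z h" "E h z" if "h \<in> G" for h
    using no_shortcut(1)[OF w that zV] exactly_one(2)[OF w that zV] no_shortcut(2)[OF w g zV] a by auto
  have no_back: "\<not> E z x" if "x \<in> Q" for x
    using no_shortcut(2)[OF that g zV] a by auto
  have "\<not> E z (hd ps)"
    using no_detour[of "ps @ gs" "[]" "[z]"] no_out(2)[of "last gs"] last_gap zV theta_facts(1) by auto
  moreover have "\<not> (E (last ys) w \<and> E z (hd zs))" if "ps = ys @ zs" "ys \<noteq> []" "zs \<noteq> []" for ys zs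
    using no_detour[of ys "zs @ gs" "[w, z]"] that z Q_outer[OF w] a w by auto
  then have "ins E w P + outs E z P \<le> length ps - 1 + of_bool (E (last ps) w) + of_bool (E z (hd ps))"
    using theta_facts by (intro no_insertion_count) auto
  ultimately have "ins E w P + outs E z P \<le> length ps"
    using theta_facts(1) by (cases ps) (auto simp: of_bool_def split: if_splits)
  moreover have "\<not> (E z y \<and> E y w)" if y: "y \<in> R" for y
  proof
    assume b: "E z y \<and> E y w"
    then have "y \<notin> Q" "y \<noteq> z" using no_back w by auto
    then show False
      using no_detour[of "ps @ gs" "[]" "[z, y, w]"] no_out(2)[of "last gs"] last_gap
        attached(2)[of w] b y z w Q_outer[OF w] theta_facts(1) by auto
  qed
  then have "outs E z R + ins E w R \<le> card R"
    using fin by (intro exclusive_count) auto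
  moreover have "outs E z G = 0" using no_out by (auto intro: outs_eq_0)
  moreover have "card V + 1 \<le> outs E z V + ins E w V"
    using ore[of z w] no_back[OF w] w z theta_facts(9-11) by blast
  ultimately show False
    using degree_split(1)[of z] degree_split(2)[of w] gap_degree_zero[OF w] card_V by linarith
qed

text \<open>
  The mirror image of \<open>no_common_sink\<close> under reversal of all arcs.
\<close>

lemma no_common_source:
  assumes z: "z \<in> R - Q" and w: "w \<in> Q" and g: "g \<in> G"
  shows "\<not> (E z w \<and> E z g)"
proof
  assume a: "E z w \<and> E z g"
  have zV: "z \<in> R" using z by simp
  have no_in: "\<not> E h z" "E z h" if "h \<in> G" for h
    using no_shortcut(2)[OF w that zV] exactly_one(1)[OF w that zV] no_shortcut(1)[OF w g zV] a by auto
  have no_back: "\<not> E x z" if "x \<in> Q" for x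
    using no_shortcut(1)[OF that g zV] a by auto
  have "\<not> E (last ps) z"
    using no_detour[of ps gs "[z]"] no_in(2)[of "hd gs"] last_gap zV theta_facts(1) by auto
  moreover have "\<not> (E (last ys) z \<and> E w (hd zs))" if "ps = ys @ zs" "ys \<noteq> []" "zs \<noteq> []" for ys zs
    using no_detour[of ys "zs @ gs" "[z, w]"] that z Q_outer[OF w] a w by auto
  then have "ins E z P + outs E w P \<le> length ps - 1 + of_bool (E (last ps) z) + of_bool (E w (hd ps))"
    using theta_facts by (intro no_insertion_count) auto
  ultimately have "ins E z P + outs E w P \<le> length ps"
    using theta_facts(1) by (cases ps) (auto simp: of_bool_def split: if_splits)
  moreover have "\<not> (E w y \<and> E y z)" if y: "y \<in> R" for y
  proof
    assume b: "E w y \<and> E y z"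
    then have "y \<notin> Q" "y \<noteq> z" using no_back w by auto
    then show False
      using no_detour[of ps gs "[w, y, z]"] no_in(2)[of "hd gs"] last_gap
        attached(1)[of w] b y z w Q_outer[OF w] theta_facts(1) by auto
  qed
  then have "outs E w R + ins E z R \<le> card R"
    using fin by (intro exclusive_count) auto
  moreover have "ins E z G = 0" using no_in by (auto intro: ins_eq_0)
  moreover have "card V + 1 \<le> outs E w V + ins E z V"
    using ore[of w z] no_back[OF w] w z theta_facts(9-11) by blast
  ultimately show False
    using degree_split(1)[of w] degree_split(2)[of z] gap_degree_zero[OF w] card_V by linarith
qed

text \<open>
  Each vertex off the configuration is a twin of the detour vertices or of the gap vertices: adjacent
  in both directions to all vertices of one kind and to none of the other.
\<close>

lemma outside_types:
  assumes z: "z \<in> R - Q"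
  shows "(\<forall>w\<in>Q. E w z \<and> E z w) \<and> (\<forall>g\<in>G. \<not> E g z \<and> \<not> E z g)
    \<or> (\<forall>g\<in>G. E g z \<and> E z g) \<and> (\<forall>w\<in>Q. \<not> E w z \<and> \<not> E z w)"
proof -
  obtain w0 g0 where wg: "w0 \<in> Q" "g0 \<in> G" using some_bypass some_gap by metis
  have zR: "z \<in> R" using z by simp
  note one = exactly_one[OF _ _ zR] and short = no_shortcut[OF _ _ zR]
    and sink = no_common_sink[OF z] and source = no_common_source[OF z]
  show ?thesis
  proof (cases "E w0 z")
    case True
    then have "\<forall>g\<in>G. \<not> E g z \<and> \<not> E z g" using wg short(1) sink by blast
    moreover from this have "\<forall>w\<in>Q. E w z \<and> E z w" using wg one by blast
    ultimately show ?thesis by blast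
  next
    case False
    then have "E z g0" using one(1) wg by blast
    then have "\<forall>w\<in>Q. \<not> E w z \<and> \<not> E z w" using wg short(1) source by blast
    moreover from this have "\<forall>g\<in>G. E g z \<and> E z g" using wg one by blast
    ultimately show ?thesis by blast
  qed
qed

text \<open>
  Together with a vertex \<open>w\<close> of the detour, such an arc would give a path of outside vertices that fits
  into the cycle where \<open>ps\<close> and \<open>gs\<close> meet.
\<close>

lemma types_separated:
  assumes x: "x \<in> R - Q" "\<forall>w\<in>Q. E w x \<and> E x w"
    and y: "y \<in> R - Q" "\<forall>g\<in>G. E g y \<and> E y g"
  shows "\<not> E x y" "\<not> E y x"
proof -
  obtain w g where w: "w \<in> Q" and g: "g \<in> G" using some_bypass some_gap by metis
  have "\<not> E g x" using outside_types[OF x(1)] x(2) w g by blast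
  then have ne: "x \<noteq> y" using y(2) g by blast
  have "w \<noteq> x" "w \<noteq> y" "w \<in> R" using w x(1) y(1) Q_outer[OF w] by auto
  moreover have "E w x" "E x w" "E (last ps) w" "E w (hd ps)" "E y (hd gs)" "E (last gs) y"
    using x(2) y(2) w attached[of w] last_gap by auto
  ultimately have *: "distinct [w, x, y]" "distinct [y, x, w]" "set [w, x, y] \<subseteq> R"
    "E w x" "E x w" "E (last ps) w" "E w (hd ps)" "E y (hd gs)" "E (last gs) y"
    using ne x(1) y(1) by auto
  show "\<not> E x y"
  proof
    assume "E x y"
    then have "successively E [w, x, y]" using *(4) by simp
    from no_detour[OF HOL.refl theta_facts(1) _ *(1) *(3) this] show False
      using *(6,8) last_gap(4) by simp
  qed
  show "\<not> E y x"
  proof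
    assume "E y x"
    then have "successively E [y, x, w]" using *(5) by simp
    from no_detour[of "ps @ gs" "[]", OF _ _ _ *(2) _ this] show False
      using *(3,7,9) last_gap(3) theta_facts(1) by simp
  qed
qed

text \<open>
  A vertex \<open>z\<close> that looks like a detour vertex \<open>w\<close> is nonadjacent to \<open>g\<close> and hence needs a degree as large as
  that of \<open>w\<close>. Outside \<open>ps\<close> it has no more neighbours than \<open>w\<close>, so it attains the bound on \<open>ps\<close>, is
  adjacent to the ends of \<open>ps\<close>, and could have been put on the detour. A vertex that looks like a gap
  vertex could be put on the cycle for the same reason.
\<close>

lemma nothing_outside: "R \<subseteq> Q"
proof
  fix z assume zR: "z \<in> R"
  show "z \<in> Q"
  proof (rule ccontr)
    assume "z \<notin> Q"
    with zR have z: "z \<in> R - Q" by simp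
    obtain w g where wg: "w \<in> Q" "g \<in> G" using some_bypass some_gap by metis
    have fR: "finite R" using fin by blast
    note tight = tight[OF wg]
    have ends: "E (last ps) z \<and> E z (hd ps)" if "length ps + 1 \<le> ins E z P + outs E z P"
      using that no_outer_insertion[OF zR] by (intro ends_adjacent)
    from outside_types[OF z] show False
    proof (elim disjE conjE)
      assume zQ: "\<forall>w\<in>Q. E w z \<and> E z w" and zG: "\<forall>g\<in>G. \<not> E g z \<and> \<not> E z g"
      have "E w y" "E y w" if "y \<in> R" "E z y \<or> E y z" for y
        using that outside_types[of y] types_separated[OF z zQ, of y] bypass_clique wg by blast+
      then have "outs E z R \<le> outs E w R" "ins E z R \<le> ins E w R"
        unfolding outs_def ins_def using fR by (auto intro!: card_mono)
      moreover have "outs E z G = 0" "ins E z G = 0"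
        using zG by (auto intro: outs_eq_0 ins_eq_0)
      moreover have "2 * card V + 2 \<le> (outs E z V + ins E z V) + (outs E g V + ins E g V)"
        using ore_sum[of z g] zG zR wg theta_facts(9-11) by blast
      ultimately have "length ps + 1 \<le> ins E z P + outs E z P"
        using tight(1,7) degree_split[of z] degree_split[of w] gap_degree_zero[OF wg(1)] by linarith
      then have "theta ps gs (z # qs)"
        using ends theta z zQ theta_facts
        by (intro thetaI) (auto simp: successively_Cons theta_def)
      from longest_bypass[OF this] show False by simp
    next
      assume zQ: "\<forall>w\<in>Q. \<not> E w z \<and> \<not> E z w" and zG: "\<forall>g\<in>G. E g z \<and> E z g"
      have "E g y" "E y g" if "y \<in> R" "E z y \<or> E y z" for y
        using that outside_types[of y] types_separated[OF _ _ z zG, of y] wg zQ by blast+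
      then have "outs E z R \<le> outs E g R" "ins E z R \<le> ins E g R"
        unfolding outs_def ins_def using fR by (auto intro!: card_mono)
      moreover have "outs E z G \<le> card G" "ins E z G \<le> card G"
        by (auto intro: outs_le_card ins_le_card)
      moreover have "2 * card V + 2 \<le> (outs E z V + ins E z V) + (outs E w V + ins E w V)"
        using ore_sum[of z w] zQ zR wg theta_facts(9-11) by blast
      ultimately have "length ps + 1 \<le> ins E z P + outs E z P"
        using tight(2,3,4,7) degree_split[of z] degree_split[of g] by linarith
      then show False
        using ends no_detour[of "ps @ gs" "[]" "[z]"] last_gap zG zR theta_facts(1) by auto
    qed
  qed
qed

end

context ore_digraph
begin

text \<open>
  The two parts are the vertex sets of the detour and of the gap in an extremal configuration. The exact
  degree sum is part of the result because it tells whether the hypothesis holds with equality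
  for pairs from different parts.
\<close>

theorem hamiltonian_or_two_cliques:
  assumes "V \<noteq> {}"
  obtains (hamiltonian) c where "cyc c" "set c = V"
  | (two_cliques) ps S T where "ps \<noteq> []" "distinct ps" "successively E ps" "S \<noteq> {}" "T \<noteq> {}"
      "set ps \<inter> S = {}" "set ps \<inter> T = {}" "S \<inter> T = {}" "set ps \<union> S \<union> T = V"
      "\<And>v. v \<in> S \<union> T \<Longrightarrow> E (last ps) v \<and> E v (hd ps)"
      "\<And>u v. u \<in> S \<Longrightarrow> v \<in> S \<Longrightarrow> E u v" "\<And>u v. u \<in> T \<Longrightarrow> v \<in> T \<Longrightarrow> E u v"
      "\<And>u v. u \<in> S \<Longrightarrow> v \<in> T \<Longrightarrow> \<not> E u v \<and> \<not> E v u"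
      "\<And>u v. u \<in> S \<Longrightarrow> v \<in> T \<Longrightarrow>
         (outs E u V + ins E u V) + (outs E v V + ins E v V) = 2 * card V + 2"
proof (cases "\<exists>c. cyc c \<and> set c = V")
  case True
  then show ?thesis using that by blast
next
  case False
  obtain v where "v \<in> V" using assms by blast
  then have "cyc [v]" using refl by (simp add: cyc_def)
  then obtain c where c: "cyc c" and max: "\<And>d. cyc d \<Longrightarrow> length d \<le> length c"
    using ex_has_greatest_nat[of cyc "[v]" length "card V + 1"] cyc_length
    by (metis less_Suc_eq_le Suc_eq_plus1)
  define \<Theta> where "\<Theta> = (\<lambda>(ps, gs, qs). theta ps gs qs \<and> length (ps @ gs) = length c)"
  \<comment> \<open>A lexicographic measure: first a short gap, then a long detour. The factor \<open>card V + 1\<close> exceeds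
    any difference in the second component.\<close>
  define \<mu> where "\<mu> = (\<lambda>(ps :: 'a list, gs :: 'a list, qs :: 'a list). length gs * (card V + 1) + (card V - length qs))"
  have len: "length qs \<le> card V" if "theta ps gs qs" for ps gs qs
    using that cyc_length[of "ps @ qs"] by (simp add: theta_def)
  obtain ps0 gs0 qs0 where "theta ps0 gs0 qs0" "length (ps0 @ gs0) = length c"
    using theta_exists[OF c] False c by blast
  then have t0: "\<Theta> (ps0, gs0, qs0)" by (simp add: \<Theta>_def)
  define t where "t = arg_min \<mu> \<Theta>"
  have least: "\<mu> t \<le> \<mu> t'" if "\<Theta> t'" for t'
    unfolding t_def using that by (rule arg_min_nat_le)
  have "\<Theta> t" unfolding t_def using t0 by (rule arg_min_natI)
  moreover obtain ps gs qs where t: "t = (ps, gs, qs)" by (cases t)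
  ultimately have th: "theta ps gs qs" "length (ps @ gs) = length c"
    by (simp_all add: \<Theta>_def)
  interpret extremal_theta V E ps gs qs
  proof
    show "theta ps gs qs" by fact
    show "length d \<le> length (ps @ gs)" if "cyc d" for d
      using max[OF that] th by simp
    show "length gs \<le> length gs'" if "theta ps' gs' qs'" "length (ps' @ gs') = length (ps @ gs)" for ps' gs' qs'
    proof (rule ccontr)
      assume "\<not> length gs \<le> length gs'"
      then have "Suc (length gs') * (card V + 1) \<le> length gs * (card V + 1)"
        by (intro mult_right_mono) auto
      moreover have "\<mu> t \<le> \<mu> (ps', gs', qs')"
        using that th by (intro least) (simp add: \<Theta>_def)
      ultimately show False by (simp add: \<mu>_def t)
    qed
    show "length qs' \<le> length qs" if "theta ps gs qs'" for qs'
    proof -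
      have "\<mu> t \<le> \<mu> (ps, gs, qs')" using that th by (intro least) (simp add: \<Theta>_def)
      then show ?thesis using len[OF that] len[OF th(1)] by (simp add: \<mu>_def t)
    qed
  qed
  show ?thesis
  proof (rule two_cliques[of ps Q G])
    show "P \<union> Q \<union> G = V" using nothing_outside theta_facts by blast
    show "E (last ps) v \<and> E v (hd ps)" if "v \<in> Q \<union> G" for v
      using attached that by blast
  qed (use theta_facts gap_nonempty bypass_clique gap_clique no_arcs_gap tight(7) in auto)
qed

text \<open>
  Woodall's theorem, again with every vertex counted among its own neighbours. The exact degree sum in
  the two-clique case falls short of twice the bound.
\<close>

corollary hamiltonian_if_ore:
  assumes "V \<noteq> {}"
    and "\<And>u v. u \<in> V \<Longrightarrow> v \<in> V \<Longrightarrow> \<not> E u v \<Longrightarrow> card V + 2 \<le> outs E u V + ins E v V"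
  obtains c where "cyc c" "set c = V"
  using assms(1)
proof (cases rule: hamiltonian_or_two_cliques)
  case (hamiltonian c)
  then show ?thesis using that by blast
next
  case (two_cliques ps S T)
  then obtain u v where uv: "u \<in> S" "v \<in> T" by blast
  then have "u \<in> V" "v \<in> V" using two_cliques by blast+
  then show ?thesis
    using two_cliques(13,14)[OF uv] assms(2)[of u v] assms(2)[of v u] by simp
qed

end

section \<open>Perfect matchings and contraction\<close>

lemma common_element:
  assumes "finite S" "card S < card {z \<in> S. p z} + card {z \<in> S. q z}"
  obtains z where "z \<in> S" "p z" "q z"
proof -
  have "card {z \<in> S. p z} + card {z \<in> S. q z}
    = card ({z \<in> S. p z} \<union> {z \<in> S. q z}) + card ({z \<in> S. p z} \<inter> {z \<in> S. q z})"
    using assms(1) by (intro card_Un_Int) auto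
  moreover have "card ({z \<in> S. p z} \<union> {z \<in> S. q z}) \<le> card S"
    using assms(1) by (intro card_mono) auto
  ultimately have "{z \<in> S. p z} \<inter> {z \<in> S. q z} \<noteq> {}" using assms(2) by fastforce
  then show ?thesis using that by blast
qed

lemma successively_clique:
  "(\<And>u v. u \<in> set xs \<Longrightarrow> v \<in> set xs \<Longrightarrow> R u v) \<Longrightarrow> successively R xs"
  by (induction xs rule: induct_list012) auto

lemma successively_reflclp:
  "distinct xs \<Longrightarrow> successively (\<lambda>u v. u = v \<or> R u v) xs \<Longrightarrow> successively R xs"
  by (induction xs rule: induct_list012) auto

locale woodall_bipartite =
  fixes X Y :: "'v set" and A :: "'v \<Rightarrow> 'v \<Rightarrow> bool"
  assumes finite_X: "finite X" and finite_Y: "finite Y" and balanced: "card Y = card X"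
    and disjoint: "X \<inter> Y = {}"
    and woodall_XY: "u \<in> X \<Longrightarrow> v \<in> Y \<Longrightarrow> \<not> A u v \<Longrightarrow> card X + 1 \<le> outs A u Y + ins A v X"
    and woodall_YX: "u \<in> Y \<Longrightarrow> v \<in> X \<Longrightarrow> \<not> A u v \<Longrightarrow> card X + 1 \<le> outs A u X + ins A v Y"
begin

definition matching :: "('v \<Rightarrow> 'v) \<Rightarrow> bool" where
  "matching f \<longleftrightarrow> bij_betw f X Y \<and> (\<forall>x\<in>X. A x (f x))"

text \<open>
  \<open>matched_path f xs\<close> describes a Hamiltonian path of the digraph that arises by contracting the arcs
  \<open>x \<rightarrow> f x\<close>, that is, the path \<open>x\<^sub>1, f x\<^sub>1, x\<^sub>2, f x\<^sub>2, \<dots>\<close> of the bipartite digraph. Indexing by \<open>X\<close>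
  keeps the vertex set of the contraction fixed while \<open>f\<close> changes.
\<close>

definition matched_path :: "('v \<Rightarrow> 'v) \<Rightarrow> 'v list \<Rightarrow> bool" where
  "matched_path f xs \<longleftrightarrow> matching f \<and> distinct xs \<and> set xs = X \<and> successively (\<lambda>x x'. A (f x) x') xs"

text \<open>
  An unmatched pair \<open>x\<close>, \<open>y\<close> that cannot extend the matching has all its neighbours matched, and together
  more of them than there are matching arcs. So some arc \<open>s \<rightarrow> f s\<close> can be replaced by
  \<open>x \<rightarrow> f s\<close> and \<open>s \<rightarrow> y\<close>.
\<close>

lemma partial_matching:
  "t \<le> card X \<Longrightarrow> \<exists>S f. S \<subseteq> X \<and> card S = t \<and> inj_on f S \<and> f ` S \<subseteq> Y \<and> (\<forall>x\<in>S. A x (f x))"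
proof (induction t)
  case 0
  show ?case by (intro exI[of _ "{}"]) auto
next
  case (Suc t)
  then obtain S f where S: "S \<subseteq> X" "card S = t" "inj_on f S" "f ` S \<subseteq> Y" "\<forall>x\<in>S. A x (f x)"
    by auto
  have fS: "finite S" using S finite_X finite_subset by blast
  have extend: ?case if "x \<in> X - S" "y \<in> Y - f ` S" "A x y" for x y
  proof (intro exI conjI)
    show "insert x S \<subseteq> X" "card (insert x S) = Suc t" using that S fS by auto
    show "inj_on (f(x := y)) (insert x S)"
      using that S by (auto simp: inj_on_def)
    show "(f(x := y)) ` insert x S \<subseteq> Y" "\<forall>z\<in>insert x S. A z ((f(x := y)) z)"
      using that S by auto
  qed
  have "card (f ` S) = t" using S card_image by blast
  then have "S \<noteq> X" "f ` S \<noteq> Y" using S(2) Suc.prems balanced by auto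
  then obtain x y where xy: "x \<in> X - S" "y \<in> Y - f ` S" using S(1,4) by blast
  show ?case
  proof (cases "(\<exists>y'\<in>Y - f ` S. A x y') \<or> (\<exists>x'\<in>X - S. A x' y)")
    case True
    then show ?thesis using extend xy by blast
  next
    case False
    have "outs A x Y = card {s \<in> S. A x (f s)}"
      unfolding outs_def by (rule bij_betw_same_card[symmetric, of f])
        (use False S in \<open>auto simp: bij_betw_def inj_on_def\<close>)
    moreover have "ins A y X = card {s \<in> S. A s y}"
      unfolding ins_def using False S by (intro arg_cong[where f = card]) auto
    moreover have "card X + 1 \<le> outs A x Y + ins A y X"
      using False xy by (intro woodall_XY) auto
    ultimately obtain s where s: "s \<in> S" "A x (f s)" "A s y"
      using common_element[of S "\<lambda>s. A x (f s)" "\<lambda>s. A s y"] fS S(2) Suc.prems by auto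
    let ?f = "f(s := y, x := f s)"
    show ?thesis
    proof (intro exI conjI)
      show "insert x S \<subseteq> X" "card (insert x S) = Suc t" using xy S fS by auto
      show "inj_on ?f (insert x S)"
        using xy S s by (auto simp: inj_on_def)
      show "?f ` insert x S \<subseteq> Y" "\<forall>z\<in>insert x S. A z (?f z)"
        using xy S s by auto
    qed
  qed
qed

lemma perfect_matching: obtains f where "matching f"
proof -
  obtain S f where S: "S \<subseteq> X" "card S = card X" "inj_on f S" "f ` S \<subseteq> Y" "\<forall>x\<in>S. A x (f x)"
    using partial_matching[of "card X"] by auto
  then have "S = X" using finite_X by (simp add: card_subset_eq)
  moreover from this have "f ` X = Y"
    using S finite_Y balanced by (metis card_image card_subset_eq)
  ultimately have "matching f" using S by (simp add: matching_def bij_betw_def)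
  then show ?thesis using that by blast
qed

lemma outs_Y: "matching f \<Longrightarrow> outs A u Y = card {x \<in> X. A u (f x)}"
  unfolding outs_def by (rule bij_betw_same_card[symmetric, of f])
    (auto simp: matching_def bij_betw_def inj_on_def)

lemma ins_Y: "matching f \<Longrightarrow> ins A v Y = card {x \<in> X. A (f x) v}"
  unfolding ins_def by (rule bij_betw_same_card[symmetric, of f])
    (auto simp: matching_def bij_betw_def inj_on_def)

lemma matching_swap:
  assumes f: "matching f" and tv: "t \<in> X" "v \<in> X" "A t (f v)" "A v (f t)"
  shows "matching (f(t := f v, v := f t))"
proof -
  let ?f = "f(t := f v, v := f t)"
  have "inj_on ?f X" using f tv by (auto simp: matching_def bij_betw_def inj_on_def)
  moreover have "?f ` X = f ` X"
  proof
    show "?f ` X \<subseteq> f ` X" using tv by auto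
    show "f ` X \<subseteq> ?f ` X"
    proof
      fix y assume "y \<in> f ` X"
      then obtain x where x: "x \<in> X" "y = f x" by blast
      have "y = ?f (if x = t then v else if x = v then t else x)" using x by auto
      moreover have "(if x = t then v else if x = v then t else x) \<in> X" using x tv by simp
      ultimately show "y \<in> ?f ` X" by blast
    qed
  qed
  ultimately show ?thesis using f tv by (auto simp: matching_def bij_betw_def)
qed

section \<open>Resolving the two-clique configuration\<close>

text \<open>
  The non-Hamiltonian outcome of \<open>hamiltonian_or_two_cliques\<close>, read in the contraction. The
  completeness of \<open>S\<close> and \<open>T\<close> includes the arcs \<open>f v \<rightarrow> v\<close>, which are invisible in the contraction.
  Empty parts are permitted, as the parts shrink in the induction below.
\<close>

definition two_cliques :: "('v \<Rightarrow> 'v) \<Rightarrow> 'v list \<Rightarrow> 'v set \<Rightarrow> 'v set \<Rightarrow> bool" where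
  "two_cliques f ps S T \<longleftrightarrow> matching f \<and> ps \<noteq> [] \<and> distinct ps \<and> successively (\<lambda>x x'. A (f x) x') ps
    \<and> set ps \<inter> S = {} \<and> set ps \<inter> T = {} \<and> S \<inter> T = {} \<and> set ps \<union> S \<union> T = X
    \<and> (\<forall>v\<in>S \<union> T. A (f (last ps)) v \<and> A (f v) (hd ps))
    \<and> (\<forall>u\<in>S. \<forall>v\<in>S. A (f u) v) \<and> (\<forall>u\<in>T. \<forall>v\<in>T. A (f u) v)"

lemma two_cliques_sym: "two_cliques f ps S T \<Longrightarrow> two_cliques f ps T S"
  unfolding two_cliques_def by blast

lemma two_cliques_finite: "two_cliques f ps S T \<Longrightarrow> finite S \<and> finite T"
  unfolding two_cliques_def using finite_X finite_subset by blast

text \<open>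
  Start at \<open>w\<close>, run through the rest of \<open>S\<close>, then the path, then \<open>T\<close> with \<open>g\<close> last.
\<close>

lemma two_cliques_cross_arc:
  assumes tc: "two_cliques f ps S T" and w: "w \<in> S" and g: "g \<in> T" and arc: "A w (f g)"
  shows "\<exists>xs. matched_path f xs \<and> A (hd xs) (f (last xs))"
proof -
  have fin: "finite (S - {w})" "finite (T - {g})" using two_cliques_finite[OF tc] by auto
  obtain ss where ss: "set ss = S - {w}" "distinct ss" using finite_distinct_list[OF fin(1)] by blast
  obtain ts where ts: "set ts = T - {g}" "distinct ts" using finite_distinct_list[OF fin(2)] by blast
  let ?R = "\<lambda>x x'. A (f x) x'"
  note * = tc[unfolded two_cliques_def]
  have sets: "set (w # ss) = S" "set (ts @ [g]) = T" using ss ts w g by auto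
  have "successively ?R (w # ss)" "successively ?R (ts @ [g])"
    using * sets by (blast intro: successively_clique)+
  moreover have "last (w # ss) \<in> S" "hd (ts @ [g]) \<in> T"
    using sets by (metis last_in_set list.distinct(1), metis hd_in_set snoc_eq_iff_butlast)
  ultimately have "successively ?R ((w # ss) @ ps @ (ts @ [g]))"
    using * unfolding successively_append_iff by (simp add: hd_append)
  moreover have "set ((w # ss) @ ps @ (ts @ [g])) = X"
    using * sets by (metis set_append Un_assoc Un_commute)
  moreover have "distinct ((w # ss) @ ps @ (ts @ [g]))"
    using ss ts * w g by auto
  ultimately have "matched_path f ((w # ss) @ ps @ (ts @ [g]))"
    using tc by (simp add: matched_path_def two_cliques_def)
  then show ?thesis using arc by (intro exI[of _ "(w # ss) @ ps @ (ts @ [g])"]) simp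
qed

text \<open>
  Exchange the matching partners of \<open>t\<close> and \<open>v\<close>. The path now runs \<open>t, f v, v, f t\<close>, where the arc
  \<open>f v \<rightarrow> v\<close> is one of those that come with the completeness of \<open>S\<close>. The first vertex of the path and
  the partner of its last vertex are unchanged, hence so is the attachment of \<open>S\<close> and \<open>T\<close>.
\<close>

lemma two_cliques_absorb:
  assumes tc: "two_cliques f ps S T" and v: "v \<in> S" and t: "t \<in> set ps" "A t (f v)" "A v (f t)"
  shows "\<exists>f' ps'. two_cliques f' ps' (S - {v}) T"
proof -
  obtain p1 p2 where p: "ps = p1 @ t # p2" using t split_list by metis
  let ?f = "f(t := f v, v := f t)" and ?ps = "p1 @ t # v # p2"
  note * = tc[unfolded two_cliques_def p]
  have ne: "t \<noteq> v" "v \<notin> set p1" "v \<notin> set p2" "t \<notin> set p1" "t \<notin> set p2" using * v by auto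
  have tv: "t \<in> X" "v \<in> X" using * v by auto
  have hd: "hd ?ps = hd ps" by (cases p1) (auto simp: p)
  have fl: "?f (last ?ps) = f (last ps)" using ne last_in_set[of p2] by (auto simp: p)
  have cong: "successively (\<lambda>x x'. A (?f x) x') qs = successively (\<lambda>x x'. A (f x) x') qs"
    if "t \<notin> set qs" "v \<notin> set qs" for qs
    using that by (intro successively_cong) auto
  have "successively (\<lambda>x x'. A (?f x) x') ?ps"
    using * v ne cong[of p1] cong[of p2] last_in_set[of p1]
    by (auto simp: successively_append_iff successively_Cons)
  moreover have "A (f u) (hd ps)" "A (f (last ps)) u" "?f u = f u" if "u \<in> S - {v} \<union> T" for u
    using that tc v t unfolding two_cliques_def by auto
  ultimately have "two_cliques ?f ?ps (S - {v}) T"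
    unfolding two_cliques_def hd fl
    using matching_swap[OF _ tv t(2,3)] * v ne by auto
  then show ?thesis by blast
qed

text \<open>
  Without arcs between the parts, the nonarcs \<open>w \<rightarrow> f g\<close> and \<open>g \<rightarrow> f w\<close> give a degree sum of at least
  \<open>2 * card X + 2\<close> for \<open>w\<close>, \<open>g\<close> and their partners, in terms of arcs from \<open>X\<close> to \<open>Y\<close>. The parts themselves supply at most \<open>2 * card S + 2 * card T\<close>
  of it, so more than \<open>2 * length ps\<close> is left for the path, and \<open>w\<close> or \<open>g\<close> has two arcs to
  one matched pair of it.
\<close>

lemma two_cliques_attraction:
  assumes tc: "two_cliques f ps S T" and w: "w \<in> S" "g \<in> T"
    and cross: "\<And>x y. x \<in> S \<and> y \<in> T \<or> x \<in> T \<and> y \<in> S \<Longrightarrow> \<not> A x (f y)"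
  shows "\<exists>v\<in>{w, g}. \<exists>t\<in>set ps. A t (f v) \<and> A v (f t)"
proof (rule ccontr)
  assume none: "\<not> ?thesis"
  note * = tc[unfolded two_cliques_def]
  have f: "matching f" using * by blast
  have fST: "finite S" "finite T" using two_cliques_finite[OF tc] by auto
  have cX: "card X = length ps + card S + card T"
  proof -
    have "card X = card (set ps \<union> S \<union> T)" using * by simp
    also have "\<dots> = card (set ps) + card S + card T"
      using * fST by (subst card_Un_disjoint; auto simp: card_Un_disjoint)
    finally show ?thesis using * distinct_card by metis
  qed
  have deg: "outs A v Y + ins A (f v) X \<le> length ps + 2 * card C"
    if v: "v \<in> {w, g}" and C: "C = (if v = w then S else T)" for v C
  proof -
    have sub: "{x \<in> X. A v (f x)} \<subseteq> {x \<in> set ps. A v (f x)} \<union> C" "{x \<in> X. A x (f v)} \<subseteq> {x \<in> set ps. A x (f v)} \<union> C"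
      using that cross w * by (auto split: if_splits)
    have fC: "finite C" using C fST by simp
    have "card {x \<in> X. A v (f x)} \<le> card {x \<in> set ps. A v (f x)} + card C"
      by (rule le_trans[OF card_mono[OF _ sub(1)] card_Un_le]) (use fC in auto)
    moreover have "card {x \<in> X. A x (f v)} \<le> card {x \<in> set ps. A x (f v)} + card C"
      by (rule le_trans[OF card_mono[OF _ sub(2)] card_Un_le]) (use fC in auto)
    moreover have "card {x \<in> set ps. A v (f x)} + card {x \<in> set ps. A x (f v)} \<le> card (set ps)"
      using common_element[of "set ps" "\<lambda>x. A v (f x)" "\<lambda>x. A x (f v)"] none v
      by (metis List.finite_set not_le)
    ultimately show ?thesis using outs_Y[OF f, of v] * distinct_card[of ps]
      by (simp add: ins_def)
  qed
  have "w \<in> X" "g \<in> X" "f w \<in> Y" "f g \<in> Y" "w \<noteq> g"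
    using * w by (auto simp: matching_def bij_betw_def)
  then have "card X + 1 \<le> outs A w Y + ins A (f g) X" "card X + 1 \<le> outs A g Y + ins A (f w) X"
    using woodall_XY[of w "f g"] woodall_XY[of g "f w"] cross w by auto
  then show False using deg[of w S] deg[of g T] cX \<open>w \<noteq> g\<close> by auto
qed

lemma two_cliques_solved:
  assumes "two_cliques f ps S T" "S \<noteq> {}" "T \<noteq> {}"
  shows "\<exists>f xs. matched_path f xs \<and> (A (f (last xs)) (hd xs) \<or> A (hd xs) (f (last xs)))"
  using assms
proof (induction "card S + card T" arbitrary: f ps S T rule: less_induct)
  case less
  show ?case
  proof (cases "\<exists>x y. (x \<in> S \<and> y \<in> T \<or> x \<in> T \<and> y \<in> S) \<and> A x (f y)")
    case True
    then show ?thesis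
      using two_cliques_cross_arc[OF less.prems(1)] two_cliques_cross_arc[OF two_cliques_sym[OF less.prems(1)]]
      by blast
  next
    case False
    obtain w g where wg: "w \<in> S" "g \<in> T" using less.prems by blast
    have absorbed: ?thesis
      if v: "v \<in> S'" and tc: "two_cliques f ps S' T'" "T' \<noteq> {}" "card S' + card T' = card S + card T"
        and t: "t \<in> set ps" "A t (f v)" "A v (f t)" for v t S' T'
    proof -
      obtain f' ps' where new: "two_cliques f' ps' (S' - {v}) T'"
        using two_cliques_absorb[OF tc(1) v t] by blast
      have smaller: "card (S' - {v}) < card S'"
        using v two_cliques_finite[OF tc(1)] by (meson card_Diff1_less)
      show ?thesis
      proof (cases "S' - {v} = {}")
        case False
        then show ?thesis using less.hyps[OF _ new] smaller tc(2,3) by simp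
      next
        case True
        obtain ts where ts: "set ts = T'" "distinct ts"
          using finite_distinct_list two_cliques_finite[OF tc(1)] by blast
        let ?R = "\<lambda>x x'. A (f' x) x'"
        note * = new[unfolded two_cliques_def True]
        have "ts \<noteq> []" using ts tc by auto
        then have ends: "hd ts \<in> T'" "last ts \<in> T'" using ts by auto
        have "successively ?R ts" using * ts by (intro successively_clique) auto
        then have "matched_path f' (ps' @ ts)"
          using * ts ends by (auto simp: matched_path_def successively_append_iff)
        moreover have "A (f' (last (ps' @ ts))) (hd (ps' @ ts))"
          using * \<open>ts \<noteq> []\<close> ends by auto
        ultimately show ?thesis by blast
      qed
    qed
    obtain v t where "v = w \<or> v = g" "t \<in> set ps" "A t (f v)" "A v (f t)"
      using two_cliques_attraction[OF less.prems(1) wg] False by blast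
    then show ?thesis
      using absorbed[of v S T t] absorbed[of v T S t] wg less.prems two_cliques_sym by fastforce
  qed
qed

section \<open>From a Hamiltonian cycle to a Hamiltonian bypass\<close>

lemma degree_ge_2:
  assumes "u \<in> X" "card X \<ge> 2"
  shows "outs A u Y \<ge> 2"
proof (cases "\<exists>v\<in>Y. \<not> A u v")
  case True
  then obtain v where v: "v \<in> Y" "\<not> A u v" by blast
  have "ins A v X \<le> card (X - {u})"
    unfolding ins_def using v finite_X by (intro card_mono) auto
  then show ?thesis using woodall_XY[OF assms(1) v] assms finite_X by simp
next
  case False
  then show ?thesis using assms(2) balanced by (simp add: outs_eq_card)
qed

definition spanning_bypass :: "'v list \<Rightarrow> bool" where
  "spanning_bypass w \<longleftrightarrow> w \<noteq> [] \<and> distinct w \<and> set w = X \<union> Y \<and> successively A w \<and> A (hd w) (last w)"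

text \<open>
  The vertex sequence of the bipartite digraph that a path of the contraction stands for.
\<close>

fun zigzag :: "('v \<Rightarrow> 'v) \<Rightarrow> 'v list \<Rightarrow> 'v list" where
  "zigzag f [] = []"
| "zigzag f (x # xs) = x # f x # zigzag f xs"

lemma zigzag_eq_Nil [simp]: "zigzag f xs = [] \<longleftrightarrow> xs = []"
  by (cases xs) auto

lemma hd_zigzag [simp]: "xs \<noteq> [] \<Longrightarrow> hd (zigzag f xs) = hd xs"
  by (cases xs) auto

lemma last_zigzag [simp]: "xs \<noteq> [] \<Longrightarrow> last (zigzag f xs) = f (last xs)"
  by (induction xs) auto

lemma set_zigzag: "set (zigzag f xs) = set xs \<union> f ` set xs"
  by (induction xs) auto

lemma distinct_zigzag:
  "matching f \<Longrightarrow> distinct xs \<Longrightarrow> set xs \<subseteq> X \<Longrightarrow> distinct (zigzag f xs)"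
proof (induction xs)
  case (Cons x xs)
  have inj: "inj_on f X" and im: "f ` X = Y" using Cons.prems(1) by (auto simp: matching_def bij_betw_def)
  have "x \<notin> f ` set xs" "x \<noteq> f x" "f x \<notin> set xs" using im disjoint Cons.prems(3) by auto
  moreover have "f x \<notin> f ` set xs" using inj Cons.prems(2,3) by (auto simp: inj_on_def)
  ultimately show ?case using Cons by (auto simp: set_zigzag)
qed simp

lemma successively_zigzag:
  "matching f \<Longrightarrow> set xs \<subseteq> X \<Longrightarrow> successively (\<lambda>x x'. A (f x) x') xs \<Longrightarrow> successively A (zigzag f xs)"
  by (induction xs rule: induct_list012) (auto simp: matching_def)

lemma bypass_of_path:
  assumes xs: "matched_path f xs" and arc: "A (hd xs) (f (last xs))" and ne: "X \<noteq> {}"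
  shows "spanning_bypass (zigzag f xs)"
proof -
  have "xs \<noteq> []" "f ` X = Y" using xs ne by (auto simp: matched_path_def matching_def bij_betw_def)
  then show ?thesis
    using xs arc distinct_zigzag[of f xs] successively_zigzag[of f xs]
    by (simp add: spanning_bypass_def matched_path_def set_zigzag)
qed

lemma matched_path_rotate:
  assumes "matched_path f (us @ vs)" "A (f (last (us @ vs))) (hd (us @ vs))"
  shows "matched_path f (vs @ us) \<and> A (f (last (vs @ us))) (hd (vs @ us))"
  using assms unfolding matched_path_def
  by (cases "us = []"; cases "vs = []") (auto simp: successively_append_iff)

text \<open>
  Rotate the cycle so that the matching arc \<open>x \<rightarrow> f x\<close> closes it, drop that arc, and let the opposite arc
  join the ends of the remaining path from \<open>f x\<close> to \<open>x\<close>.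
\<close>

lemma bypass_of_opposite_arcs:
  assumes xs: "matched_path f xs" "A (f (last xs)) (hd xs)" and x: "x \<in> X" "A (f x) x"
  shows "\<exists>w. spanning_bypass w"
proof -
  have "x \<in> set xs" using xs x by (simp add: matched_path_def)
  then obtain us vs where "xs = us @ x # vs" using split_list by metis
  then have "matched_path f ((vs @ us) @ [x])" and close: "A (f x) (hd ((vs @ us) @ [x]))"
    using matched_path_rotate[of f "us @ [x]" vs] xs by auto
  then obtain ys where ys: "matched_path f (ys @ [x])" "A (f x) (hd (ys @ [x]))" by blast
  note * = ys(1)[unfolded matched_path_def]
  have f: "matching f" "x \<in> X" "set ys \<subseteq> X" "distinct ys" "x \<notin> set ys" "f ` X = Y" "inj_on f X"
    using * by (auto simp: matching_def bij_betw_def)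
  have XY: "u \<noteq> f v" if "u \<in> X" "v \<in> X" for u v using that f disjoint by auto
  have "successively (\<lambda>x x'. A (f x) x') ys" "ys \<noteq> [] \<Longrightarrow> A (f (last ys)) x"
    using * by (auto simp: successively_append_iff)
  then have "successively A (f x # zigzag f ys @ [x])"
    using successively_zigzag[OF f(1,3)] ys(2)
    by (cases "ys = []") (auto simp: successively_append_iff successively_Cons)
  moreover have "f x \<notin> set ys" "f x \<noteq> x" "x \<notin> f ` set ys" "f x \<notin> f ` set ys"
    using XY f by (blast, metis, blast, auto dest: inj_onD)
  then have "distinct (f x # zigzag f ys @ [x])"
    using distinct_zigzag[OF f(1,4,3)] f(5) by (simp add: set_zigzag)
  moreover have "set (f x # zigzag f ys @ [x]) = X \<union> Y"
    using * f(6) by (auto simp: set_zigzag)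
  ultimately have "spanning_bypass (f x # zigzag f ys @ [x])"
    using x(2) by (simp add: spanning_bypass_def)
  then show ?thesis by blast
qed

text \<open>
  Merge \<open>i\<close> and \<open>j\<close>: the merged vertex is represented by \<open>j\<close>, is entered at \<open>j\<close> and left from \<open>f i\<close>. A
  Hamiltonian cycle through it, cut open there, is a Hamiltonian path from \<open>i\<close> to \<open>j\<close>. Each vertex loses at
  most one neighbour by the merging and gains itself as a neighbour, since there are no loops \<open>f x \<rightarrow> x\<close>.
  So the bound \<open>card X + 1\<close> survives, which is Woodall's bound for \<open>card X - 1\<close> vertices.
\<close>

lemma matched_path_between:
  assumes f: "matching f" and no_loop: "\<And>x. x \<in> X \<Longrightarrow> \<not> A (f x) x"
    and ij: "i \<in> X" "j \<in> X" "i \<noteq> j" and X3: "card X \<ge> 3"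
  shows "\<exists>xs. matched_path f xs \<and> hd xs = i \<and> last xs = j"
proof -
  define V where "V = X - {i}"
  define h where "h = f(j := f i)"
  define E where "E u v \<longleftrightarrow> u = v \<or> A (h u) v" for u v
  have cV: "card V + 1 = card X" unfolding V_def using card_Suc_Diff1[OF finite_X ij(1)] by simp
  have fV: "finite V" using finite_X by (simp add: V_def)
  have hY: "h u \<in> Y" if "u \<in> V" for u
    using that f ij by (auto simp: h_def V_def matching_def bij_betw_def)
  have out: "outs A (h u) X \<le> outs E u V" if u: "u \<in> V" for u
  proof -
    let ?N = "{z \<in> X. A (h u) z}"
    have N: "{z \<in> V. E u z} = insert u (?N - {i})" using u by (auto simp: E_def V_def)
    have "u \<notin> ?N \<or> i \<notin> ?N" using no_loop u ij by (auto simp: h_def V_def)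
    moreover have "finite ?N" "u \<noteq> i" using finite_X u by (auto simp: V_def)
    ultimately have "card ?N \<le> card (insert u (?N - {i}))"
      by (cases "u \<in> ?N"; cases "i \<in> ?N") (auto simp: card_Diff_singleton_if card_insert_if)
    then show ?thesis unfolding outs_def N .
  qed
  have inn: "ins A v Y \<le> ins E v V" if v: "v \<in> V" for v
  proof -
    \<comment> \<open>In the merged digraph \<open>j\<close> does the duty of \<open>i\<close>. The predecessor \<open>j\<close>, which may be lost, is replaced
      by \<open>v\<close> itself, which is not among the old predecessors.\<close>
    let ?M = "{x \<in> X. A (f x) v}" and ?s = "\<lambda>x. if x = i then j else if x = j then v else x"
    have "v \<notin> ?M" "v \<noteq> i" using no_loop v by (auto simp: V_def)
    then have "inj_on ?s ?M" by (auto simp: inj_on_def)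
    moreover have "?s ` ?M \<subseteq> {z \<in> V. E z v}"
      using v ij by (auto simp: E_def V_def h_def)
    ultimately have "card ?M \<le> card {z \<in> V. E z v}" using fV by (intro card_inj_on_le) auto
    then show ?thesis unfolding ins_Y[OF f] by (simp add: ins_def)
  qed
  have ore: "card V + 2 \<le> outs E u V + ins E v V" if "u \<in> V" "v \<in> V" "\<not> E u v" for u v
  proof -
    have "card X + 1 \<le> outs A (h u) X + ins A v Y"
      using that hY[of u] by (intro woodall_YX) (auto simp: E_def V_def)
    then show ?thesis using out[OF that(1)] inn[OF that(2)] cV by linarith
  qed
  interpret D: ore_digraph V E
  proof
    show "card V + 1 \<le> outs E u V + ins E v V" if "u \<in> V" "v \<in> V" "\<not> E u v" for u v
      using ore[OF that] by simp
  qed (use fV in \<open>auto simp: E_def\<close>)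
  have jV: "j \<in> V" using ij by (simp add: V_def)
  obtain c where c: "D.cyc c" "set c = V" using D.hamiltonian_if_ore[OF _ ore] jV by blast
  then obtain us vs where "c = us @ j # vs" using jV split_list by metis
  then have c': "D.cyc ((vs @ us) @ [j])" "set ((vs @ us) @ [j]) = V"
    using D.cyc_rotate[of "us @ [j]" vs] c by auto
  then obtain ys where ys: "D.cyc (ys @ [j])" "set (ys @ [j]) = V" by blast
  have d: "distinct (ys @ [j])" using ys by (simp add: D.cyc_def)
  have "length (ys @ [j]) = card V" using d ys(2) distinct_card by metis
  then have ne: "ys \<noteq> []" using cV X3 by auto
  have "E = (\<lambda>u v. u = v \<or> A (h u) v)" by (simp add: E_def fun_eq_iff)
  moreover have "successively E (ys @ [j])" using ys by (simp add: D.cyc_def)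
  ultimately have "successively (\<lambda>u v. A (h u) v) (ys @ [j])"
    using successively_reflclp[OF d] by metis
  then have "successively (\<lambda>u v. A (h u) v) ys" "A (h (last ys)) j"
    using ne by (auto simp: successively_append_iff)
  moreover have "successively (\<lambda>u v. A (h u) v) ys = successively (\<lambda>u v. A (f u) v) ys"
    using d by (intro successively_cong) (auto simp: h_def)
  moreover have "last ys \<noteq> j" using d ne by auto
  moreover have "E j (hd ys)" "j \<noteq> hd ys" using ys(1) d ne by (auto simp: D.cyc_def)
  ultimately have "successively (\<lambda>u v. A (f u) v) (i # ys @ [j])"
    using ne by (auto simp: successively_append_iff successively_Cons E_def h_def)
  moreover have "distinct (i # ys @ [j])" "set (i # ys @ [j]) = X"
    using d ys(2) ij by (auto simp: V_def)
  ultimately have "matched_path f (i # ys @ [j])" using f by (simp add: matched_path_def)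
  then show ?thesis by (intro exI[of _ "i # ys @ [j]"]) simp
qed

lemma bypass_of_cycle:
  assumes xs: "matched_path f xs" "A (f (last xs)) (hd xs)" and X3: "card X \<ge> 3"
  shows "\<exists>w. spanning_bypass w"
proof (cases "\<exists>x\<in>X. A (f x) x")
  case True
  then show ?thesis using bypass_of_opposite_arcs xs by blast
next
  case False
  have f: "matching f" using xs by (simp add: matched_path_def)
  obtain i where i: "i \<in> X" using X3 by fastforce
  have "2 \<le> card {y \<in> Y. A i y}" using degree_ge_2[OF i] X3 by (simp add: outs_def)
  moreover have "card {y \<in> Y. A i y} \<le> 1" if "{y \<in> Y. A i y} \<subseteq> {f i}"
    using card_mono[OF _ that] by simp
  ultimately have "\<not> {y \<in> Y. A i y} \<subseteq> {f i}" by linarith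
  then obtain y where y: "y \<in> Y" "A i y" "y \<noteq> f i" by blast
  have "f ` X = Y" using f by (simp add: matching_def bij_betw_def)
  with y obtain j where j: "j \<in> X" "A i (f j)" "i \<noteq> j" by blast
  have "\<And>x. x \<in> X \<Longrightarrow> \<not> A (f x) x" using False by blast
  from matched_path_between[OF f this i j(1,3) X3]
  obtain p where "matched_path f p" "hd p = i" "last p = j" by blast
  then show ?thesis using bypass_of_path[of f p] j(2) i by auto
qed

text \<open>
  In the reflexive closure of the contraction, a vertex \<open>u\<close> without an arc \<open>f u \<rightarrow> u\<close> gains one neighbour.
  Therefore the exact degree sum of the two-clique outcome forces these arcs for all vertices in the two parts.
\<close>

lemma cycle_or_two_cliques:
  assumes f: "matching f" and X2: "card X \<ge> 2"
  shows "(\<exists>xs. matched_path f xs \<and> A (f (last xs)) (hd xs))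
    \<or> (\<exists>ps S T. two_cliques f ps S T \<and> S \<noteq> {} \<and> T \<noteq> {})"
proof -
  define E where "E u v \<longleftrightarrow> u = v \<or> A (f u) v" for u v
  have out: "outs A (f u) X + of_bool (\<not> A (f u) u) \<le> outs E u X" if u: "u \<in> X" for u
  proof -
    have "{z \<in> X. E u z} = insert u {z \<in> X. A (f u) z}" using u by (auto simp: E_def)
    then show ?thesis using finite_X by (simp add: outs_def card_insert_if)
  qed
  have inn: "ins A v Y + of_bool (\<not> A (f v) v) \<le> ins E v X" if v: "v \<in> X" for v
  proof -
    have "{z \<in> X. E z v} = insert v {z \<in> X. A (f z) v}" using v by (auto simp: E_def)
    then show ?thesis unfolding ins_Y[OF f] using finite_X by (simp add: ins_def card_insert_if)
  qed
  have ore: "card X + 1 + of_bool (\<not> A (f u) u) + of_bool (\<not> A (f v) v) \<le> outs E u X + ins E v X"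
    if "u \<in> X" "v \<in> X" "\<not> E u v" for u v
  proof -
    have "f u \<in> Y" using f that by (auto simp: matching_def bij_betw_def)
    then have "card X + 1 \<le> outs A (f u) X + ins A v Y"
      using that by (intro woodall_YX) (auto simp: E_def)
    then show ?thesis using out[OF that(1)] inn[OF that(2)] by linarith
  qed
  interpret D: ore_digraph X E
  proof
    show "card X + 1 \<le> outs E u X + ins E v X" if "u \<in> X" "v \<in> X" "\<not> E u v" for u v
      using ore[OF that] by linarith
  qed (use finite_X in \<open>auto simp: E_def\<close>)
  have E_eq: "E = (\<lambda>u v. u = v \<or> A (f u) v)" by (simp add: E_def fun_eq_iff)
  have path: "successively (\<lambda>x x'. A (f x) x') xs" if "distinct xs" "successively E xs" for xs
    using that successively_reflclp[of xs "\<lambda>u v. A (f u) v"] E_eq by metis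
  have "X \<noteq> {}" using X2 by auto
  then show ?thesis
  proof (cases rule: D.hamiltonian_or_two_cliques)
    case (hamiltonian c)
    then have c: "distinct c" "successively E c" "E (last c) (hd c)" by (auto simp: D.cyc_def)
    have "length c \<ge> 2" using X2 hamiltonian(2) distinct_card[OF c(1)] by simp
    then have "last c \<noteq> hd c" using c(1) by (cases c) auto
    then have "matched_path f c" "A (f (last c)) (hd c)"
      using f c path hamiltonian(2) by (auto simp: matched_path_def E_def)
    then show ?thesis by blast
  next
    case (two_cliques ps S T)
    have loops: "A (f u) u \<and> A (f v) v" if uv: "u \<in> S" "v \<in> T" for u v
    proof -
      have "u \<in> X" "v \<in> X" using uv two_cliques(9) by auto
      then show ?thesis
        using ore[of u v] ore[of v u] two_cliques(13,14)[OF uv] by (auto simp: of_bool_def split: if_splits)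
    qed
    have loop: "A (f v) v" if "v \<in> S \<union> T" for v
      using that loops two_cliques(4,5) by blast
    have "last ps \<in> set ps" "hd ps \<in> set ps" using two_cliques(1) by auto
    then have "A (f (last ps)) v \<and> A (f v) (hd ps)" if "v \<in> S \<union> T" for v
      using that two_cliques(6,7) two_cliques(10)[of v] by (auto simp: E_def)
    moreover have "A (f u) v" if "u \<in> S \<and> v \<in> S \<or> u \<in> T \<and> v \<in> T" for u v
      using that two_cliques(11,12)[of u v] loop[of u] by (auto simp: E_def)
    ultimately have "two_cliques f ps S T"
      unfolding two_cliques_def using f path two_cliques(1-3,6-9) by simp
    then show ?thesis using two_cliques(4,5) by blast
  qed
qed

theorem spanning_bypass_exists:
  assumes "card X \<ge> 3"
  shows "\<exists>w. spanning_bypass w"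
proof -
  obtain f where "matching f" using perfect_matching by blast
  then obtain f xs where "matched_path f xs" "A (f (last xs)) (hd xs) \<or> A (hd xs) (f (last xs))"
    using cycle_or_two_cliques[of f] two_cliques_solved[of f] assms by (auto; blast)
  moreover have "X \<noteq> {}" using assms by auto
  ultimately show ?thesis using bypass_of_cycle[OF _ _ assms] bypass_of_path by blast
qed

end

section \<open>Hamiltonian bypasses in balanced bipartite digraphs\<close>

lemma (in nomulti_digraph) out_degree_eq_card_successors: "out_degree G u = card {v. dominates G u v}"
proof -
  have "inj_on (head G) (out_arcs G u)"
    using no_multi_arcs by (auto simp: inj_on_def arc_to_ends_def)
  moreover have "head G ` out_arcs G u = {v. dominates G u v}"
    by (auto simp: arcs_ends_conv image_iff)
  ultimately show ?thesis unfolding out_degree_def by (metis card_image)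
qed

lemma (in nomulti_digraph) in_degree_eq_card_predecessors: "in_degree G v = card {u. dominates G u v}"
proof -
  have "inj_on (tail G) (in_arcs G v)"
    using no_multi_arcs by (auto simp: inj_on_def arc_to_ends_def)
  moreover have "tail G ` in_arcs G v = {u. dominates G u v}"
    by (auto simp: arcs_ends_conv image_iff)
  ultimately show ?thesis unfolding in_degree_def by (metis card_image)
qed

theorem theorem1p6:
  fixes B :: "('v, 'e) pre_digraph" and X Y :: "'v set" and a :: nat
  assumes "balanced_bipartite_digraph B X Y a"
    and "strongly_connected B"
    and "2 * a \<ge> 6"
    and "\<And>u v. (u \<in> X \<and> v \<in> Y) \<or> (u \<in> Y \<and> v \<in> X) \<Longrightarrow> \<not> u \<rightarrow>\<^bsub>B\<^esub> v \<Longrightarrow>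
           out_degree B u + in_degree B v \<ge> a + 1"
  shows "\<exists>w. hamiltonian_bypass B w"
proof -
  let ?A = "dominates B"
  interpret digraph B using assms(1) by (simp add: balanced_bipartite_digraph_def)
  have XY: "verts B = X \<union> Y" "X \<inter> Y = {}" "card X = a" "card Y = a"
    and bip: "\<And>u v. ?A u v \<Longrightarrow> u \<in> X \<and> v \<in> Y \<or> u \<in> Y \<and> v \<in> X"
    using assms(1) unfolding balanced_bipartite_digraph_def by blast+
  have fin: "finite X" "finite Y" using finite_verts XY(1) by auto
  have out: "out_degree B u = outs ?A u S" if "\<And>v. ?A u v \<Longrightarrow> v \<in> S" for u S
    unfolding out_degree_eq_card_successors outs_def using that by (intro arg_cong[where f = card]) auto
  have inn: "in_degree B v = ins ?A v S" if "\<And>u. ?A u v \<Longrightarrow> u \<in> S" for v S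
    unfolding in_degree_eq_card_predecessors ins_def using that by (intro arg_cong[where f = card]) auto
  interpret woodall_bipartite X Y ?A
  proof
    fix u v assume uv: "u \<in> X" "v \<in> Y" and no: "\<not> ?A u v"
    have "out_degree B u = outs ?A u Y" by (rule out) (use bip uv XY(2) in blast)
    moreover have "in_degree B v = ins ?A v X" by (rule inn) (use bip uv XY(2) in blast)
    ultimately show "card X + 1 \<le> outs ?A u Y + ins ?A v X"
      using assms(4)[of u v] uv no XY(3) by simp
  next
    fix u v assume uv: "u \<in> Y" "v \<in> X" and no: "\<not> ?A u v"
    have "out_degree B u = outs ?A u X" by (rule out) (use bip uv XY(2) in blast)
    moreover have "in_degree B v = ins ?A v Y" by (rule inn) (use bip uv XY(2) in blast)
    ultimately show "card X + 1 \<le> outs ?A u X + ins ?A v Y"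
      using assms(4)[of u v] uv no XY(3) by simp
  qed (use fin XY in auto)
  obtain w where w: "spanning_bypass w" using spanning_bypass_exists XY(3) assms(3) by auto
  have "set (vwalk_arcs xs) \<subseteq> arcs_ends B" if "successively ?A xs" for xs
    using that by (induction xs rule: vwalk_arcs.induct) auto
  then have "hamiltonian_bypass B w"
    using w XY(1) by (auto simp: hamiltonian_bypass_def spanning_bypass_def vpath_def vwalk_def)
  then show ?thesis by blast
qed

end
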